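(* Let $v,w\ge 0$ be integers with $v+w\ge 5$. (1) If $w\ge 1$, then $cost\ \mathscr{ON}(v+w,v;4,3)=cost\ \mathscr{ON}(v+w,4)$. (2) If $w=0$, then $cost\ \mathscr{ON}(v+0,v;4,3)=cost\ \mathscr{ON}(v,3)$.
   Context: Let $n\ge v\ge 0$ and let $C>C'\ge 1$ be integers. Let $X$ be a set of $n$ vertices, $K_n$ the complete graph on $X$, and $V\subseteq X$ a fixed subset with $|V|=v$; write $w=n-v$. A grooming $N(n,C)$ is a partition of the edge set $E(K_n)$ into (nonempty, not necessarily connected) subgraphs $B_1,\dots,B_\Lambda$ of $K_n$, without isolated vertices, such that $|E(B_k)|\le C$ for all $k$. A grooming $N(n,v;C,C')$ is an $N(n,C)$ in which, moreover, each $B_k$ contains at most $C'$ edges having both ends in $V$. The (drop) cost of a grooming is $\sum_{k=1}^{\Lambda}|V(B_k)|$. $\mathscr{ON}(n,C)$ (respectively $\mathscr{ON}(n,v;C,C')$) denotes a grooming $N(n,C)$ (respectively $N(n,v;C,C')$) of minimum cost, and $cost\ \mathscr{ON}(n,C)$ (respectively $cost\ \mathscr{ON}(n,v;C,C')$) denotes that minimum cost. *)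

theory Defs
  imports "HOL-Library.Disjoint_Sets"
begin

definition complete_edges :: "'a set \<Rightarrow> 'a set set" where
  "complete_edges X = {e. e \<subseteq> X \<and> card e = 2}"

text \<open>
  A graph without isolated vertices is determined by its edge set \<open>B\<close>, and its vertex set
  is then \<open>\<Union>B\<close>. Subgraphs are therefore represented by their edge sets, and a
  decomposition of the complete graph by a set \<open>P\<close> of pairwise disjoint, nonempty
  edge sets (\<^const>\<open>partition_on\<close> excludes the empty block).
\<close>

definition grooming :: "'a set \<Rightarrow> nat \<Rightarrow> 'a set set set \<Rightarrow> bool" where
  "grooming X C P \<longleftrightarrow>
     partition_on (complete_edges X) P \<and> (\<forall>B\<in>P. card B \<le> C)"

definition grooming2 :: "'a set \<Rightarrow> 'a set \<Rightarrow> nat \<Rightarrow> nat \<Rightarrow> 'a set set set \<Rightarrow> bool" where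
  "grooming2 X V C C' P \<longleftrightarrow>
     grooming X C P \<and> (\<forall>B\<in>P. card {e \<in> B. e \<subseteq> V} \<le> C')"

definition drop_cost :: "'a set set set \<Rightarrow> nat" where
  "drop_cost P = (\<Sum>B\<in>P. card (\<Union>B))"

text \<open>
  The infimum below is that of \<^typ>\<open>nat\<close>; it is an attained minimum as soon as some
  grooming exists, which is the case for positive bounds: see
  \<open>cost_ON_attained\<close> and \<open>cost_ON2_attained\<close>.
\<close>

definition cost_ON :: "'a set \<Rightarrow> nat \<Rightarrow> nat" where
  "cost_ON X C = Inf (drop_cost ` {P. grooming X C P})"

definition cost_ON2 :: "'a set \<Rightarrow> 'a set \<Rightarrow> nat \<Rightarrow> nat \<Rightarrow> nat" where
  "cost_ON2 X V C C' = Inf (drop_cost ` {P. grooming2 X V C C' P})"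

lemma grooming2_exists:
  assumes "C \<ge> 1" "C' \<ge> 1"
  shows "grooming2 X V C C' ((\<lambda>e. {e}) ` complete_edges X)"
proof -
  have "card {e' \<in> {e}. e' \<subseteq> V} \<le> 1" for e :: "'a set"
    using card_mono[of "{e}" "{e' \<in> {e}. e' \<subseteq> V}"] by auto
  moreover have "partition_on (complete_edges X) ((\<lambda>e. {e}) ` complete_edges X)"
    by (auto simp: partition_on_def disjoint_def)
  ultimately show ?thesis
    using assms order_trans unfolding grooming2_def grooming_def by fastforce
qed

lemma cost_ON_attained:
  assumes "C \<ge> 1"
  shows "\<exists>P. grooming X C P \<and> drop_cost P = cost_ON X C
           \<and> (\<forall>Q. grooming X C Q \<longrightarrow> drop_cost P \<le> drop_cost Q)"
proof -
  let ?S = "drop_cost ` {P. grooming X C P}"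
  have "?S \<noteq> {}"
    using grooming2_exists[of C 1 X "{}"] assms by (auto simp: grooming2_def)
  then have "Inf ?S \<in> ?S" by (rule Inf_nat_def1)
  then obtain P where P: "grooming X C P" "drop_cost P = Inf ?S" by auto
  moreover have "Inf ?S \<le> drop_cost Q" if "grooming X C Q" for Q
    using that by (intro cInf_lower) auto
  ultimately show ?thesis unfolding cost_ON_def by metis
qed

lemma cost_ON2_attained:
  assumes "C \<ge> 1" "C' \<ge> 1"
  shows "\<exists>P. grooming2 X V C C' P \<and> drop_cost P = cost_ON2 X V C C'
           \<and> (\<forall>Q. grooming2 X V C C' Q \<longrightarrow> drop_cost P \<le> drop_cost Q)"
proof -
  let ?S = "drop_cost ` {P. grooming2 X V C C' P}"
  have "?S \<noteq> {}"
    using grooming2_exists[OF assms, of X V] by auto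
  then have "Inf ?S \<in> ?S" by (rule Inf_nat_def1)
  then obtain P where P: "grooming2 X V C C' P" "drop_cost P = Inf ?S" by auto
  moreover have "Inf ?S \<le> drop_cost Q" if "grooming2 X V C C' Q" for Q
    using that by (intro cInf_lower) auto
  ultimately show ?thesis unfolding cost_ON2_def by metis
qed

end

theory Submission
  imports Defs
begin

text \<open>
  A graph with at most four edges has at least as many vertices as edges, so every grooming with
  \<open>C = 4\<close> costs at least the number of edges of the complete graph. If \<open>w \<ge> 1\<close>, fix a vertex
  \<open>x\<close> outside \<open>V\<close>; it suffices to decompose the complete graph into triangles and into
  4-cycles and triangles with a pendant edge, the blocks of the last two kinds containing \<open>x\<close>:
  such a block has at most three edges inside \<open>V\<close>. The triangles come from the Bose and
  Skolem constructions on \<open>\<int>\<^sub>m \<times> {0, 1, 2}\<close>, where \<open>m = n div 3\<close>. The triple system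
  on \<open>3m\<close> points is complete for odd \<open>m\<close> and leaves a perfect matching for even \<open>m\<close>, which a
  further point turns into triangles. The remaining residues of \<open>n\<close> modulo 6 are reached by
  attaching the edges at a new vertex \<open>x\<close>, or the edges of the matching, as pendant edges to
  distinct triples, or by adding two vertices joined by 4-cycles through both of them.
\<close>

section \<open>Triple packings, pinned decompositions and complete graphs\<close>

definition triple_packing :: "'a set \<Rightarrow> 'a set set \<Rightarrow> bool" where
  "triple_packing X T \<longleftrightarrow> (\<forall>t\<in>T. t \<subseteq> X \<and> card t = 3) \<and>
     (\<forall>s\<in>T. \<forall>t\<in>T. \<forall>p\<in>s \<inter> t. \<forall>q\<in>s \<inter> t. p \<noteq> q \<longrightarrow> s = t)"

definition leave :: "'a set \<Rightarrow> 'a set set \<Rightarrow> 'a set set" where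
  "leave X T = {e \<in> complete_edges X. \<forall>t\<in>T. \<not> e \<subseteq> t}"

text \<open>The vertex bound keeps the cost at most the number of edges. Counting the edges that
  miss \<open>x\<close>, rather than those inside \<open>V\<close>, frees the notion from
  \<open>V\<close>: one decomposition serves every \<open>V\<close> that avoids
  \<open>x\<close>.\<close>

definition pinned :: "'a set set \<Rightarrow> 'a \<Rightarrow> 'a set set set \<Rightarrow> bool" where
  "pinned E x P \<longleftrightarrow> partition_on E P \<and>
     (\<forall>B\<in>P. card (\<Union>B) \<le> card B \<and> card B \<le> 4 \<and> card {e \<in> B. x \<notin> e} \<le> 3)"

lemma triple_packing_unique:
  "triple_packing X T \<Longrightarrow> s \<in> T \<Longrightarrow> t \<in> T \<Longrightarrow> p \<in> s \<Longrightarrow> p \<in> t \<Longrightarrow> q \<in> s \<Longrightarrow> q \<in> t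
    \<Longrightarrow> p \<noteq> q \<Longrightarrow> s = t"
  unfolding triple_packing_def by blast

lemma complete_edges_iff: "e \<in> complete_edges X \<longleftrightarrow> (\<exists>p q. e = {p, q} \<and> p \<in> X \<and> q \<in> X \<and> p \<noteq> q)"
  unfolding complete_edges_def card_2_iff by auto

lemma doubleton_in_complete_edges: "{p, q} \<in> complete_edges X \<longleftrightarrow> p \<in> X \<and> q \<in> X \<and> p \<noteq> q"
  by (auto simp: complete_edges_def card_insert_if)

lemma complete_edges_insert:
  "complete_edges (insert x X) = complete_edges X \<union> (\<lambda>p. {x, p}) ` (X - {x})"
  unfolding set_eq_iff complete_edges_iff Un_iff image_iff by (auto simp: insert_commute)

lemma finite_complete_edges: "finite X \<Longrightarrow> finite (complete_edges X)"
  unfolding complete_edges_def by (rule finite_subset[of _ "Pow X"]) auto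

lemma card_complete_edges: "finite X \<Longrightarrow> card (complete_edges X) = card X choose 2"
  unfolding complete_edges_def by (rule n_subsets)

lemma Union_complete_edges:
  assumes "card t = 3" shows "\<Union>(complete_edges t) = t"
proof -
  obtain p q r where "t = {p, q, r}" "p \<noteq> q" "p \<noteq> r" "q \<noteq> r"
    using assms unfolding card_3_iff by auto
  then have "{p, q} \<in> complete_edges t" "{p, r} \<in> complete_edges t" by (auto simp: complete_edges_def)
  then have "t \<subseteq> \<Union>(complete_edges t)" using \<open>t = {p, q, r}\<close> by blast
  then show ?thesis by (auto simp: complete_edges_def)
qed

lemma card_complete_edges_triple: "card t = 3 \<Longrightarrow> card (complete_edges t) = 3"
  by (subst card_complete_edges) (auto intro: card_ge_0_finite simp: choose_two)

section \<open>Lower bound on the cost and its attainment\<close>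

text \<open>On \<open>k \<le> 3\<close> vertices there are at most \<open>k choose 2 \<le> k\<close>
  edges; from four vertices on, the bound of four edges suffices.\<close>

lemma card_le_card_Union:
  assumes fin: "finite (\<Union>B)" and B: "B \<subseteq> complete_edges X" and le: "card B \<le> 4"
  shows "card B \<le> card (\<Union>B)"
proof (cases "card (\<Union>B) \<ge> 4")
  case False
  have "B \<subseteq> complete_edges (\<Union>B)"
    using B unfolding complete_edges_def by auto
  then have "card B \<le> card (\<Union>B) choose 2"
    using card_mono finite_complete_edges[OF fin] card_complete_edges[OF fin] by metis
  moreover have "card (\<Union>B) \<in> {0, 1, 2, 3}" using False by auto
  ultimately show ?thesis by (auto simp: choose_two)
qed (use le in simp)

lemma sum_card_partition:
  assumes "partition_on E P" "finite E"
  shows "(\<Sum>B\<in>P. card B) = card E"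
proof -
  have "\<Union>P = E" "disjoint P" using assms(1) unfolding partition_on_def by auto
  moreover have "finite B" if "B \<in> P" for B
    using that calculation(1) assms(2) by (meson Union_upper finite_subset)
  ultimately show ?thesis
    by (metis card_Union_disjoint disjoint_def disjnt_def pairwise_def)
qed

lemma drop_cost_ge:
  assumes fin: "finite X" and P: "grooming X 4 P"
  shows "card X choose 2 \<le> drop_cost P"
proof -
  have part: "partition_on (complete_edges X) P" and le: "\<And>B. B \<in> P \<Longrightarrow> card B \<le> 4"
    using P unfolding grooming_def by auto
  have "card B \<le> card (\<Union>B)" if "B \<in> P" for B
  proof (rule card_le_card_Union)
    show sub: "B \<subseteq> complete_edges X" using part that unfolding partition_on_def by auto
    then show "finite (\<Union>B)" using fin
      by (auto simp: complete_edges_def intro!: finite_subset[of "\<Union>B" X])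
  qed (use le that in auto)
  then have "(\<Sum>B\<in>P. card B) \<le> (\<Sum>B\<in>P. card (\<Union>B))" by (rule sum_mono)
  then show ?thesis
    using sum_card_partition[OF part finite_complete_edges[OF fin]] card_complete_edges[OF fin]
    unfolding drop_cost_def by simp
qed

text \<open>A squeeze: \<open>card X choose 2\<close> bounds every grooming from below, the
  restricted minimum is at least the free one, and \<open>P\<close> meets both the restriction and
  the lower bound.\<close>

lemma cost_eq_if_pinned:
  assumes fin: "finite X" and x: "x \<notin> V" and P: "pinned (complete_edges X) x P"
  shows "cost_ON2 X V 4 3 = cost_ON X 4"
proof -
  have part: "partition_on (complete_edges X) P" using P unfolding pinned_def by auto
  have finB: "finite B" if "B \<in> P" for B
    using that partition_onD1[OF part] by (intro finite_subset[OF _ finite_complete_edges[OF fin]]) auto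
  have "card {e \<in> B. e \<subseteq> V} \<le> 3" if "B \<in> P" for B
  proof -
    have "card {e \<in> B. e \<subseteq> V} \<le> card {e \<in> B. x \<notin> e}"
      using x finB[OF that] by (intro card_mono) auto
    then show ?thesis using P that unfolding pinned_def by fastforce
  qed
  then have P2: "grooming2 X V 4 3 P"
    using P unfolding grooming2_def grooming_def pinned_def by auto
  moreover obtain Q where Q: "grooming2 X V 4 3 Q" "drop_cost Q = cost_ON2 X V 4 3"
      "\<And>R. grooming2 X V 4 3 R \<Longrightarrow> drop_cost Q \<le> drop_cost R"
    using cost_ON2_attained[of 4 3 X V] by auto
  moreover obtain Q' where Q': "grooming X 4 Q'" "drop_cost Q' = cost_ON X 4"
      "\<And>R. grooming X 4 R \<Longrightarrow> drop_cost Q' \<le> drop_cost R"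
    using cost_ON_attained[of 4 X] by auto
  moreover have "drop_cost P \<le> (\<Sum>B\<in>P. card B)"
    using P unfolding drop_cost_def pinned_def by (auto intro: sum_mono)
  moreover have "(\<Sum>B\<in>P. card B) = card X choose 2"
    using sum_card_partition[OF part finite_complete_edges[OF fin]] card_complete_edges[OF fin] by simp
  moreover have "grooming X 4 Q" using Q(1) unfolding grooming2_def by auto
  then have "drop_cost Q' \<le> drop_cost Q" by (rule Q'(3))
  ultimately show ?thesis
    using drop_cost_ge[OF fin Q'(1)] Q(3)[OF P2] by linarith
qed

section \<open>Unions and transport of pinned decompositions\<close>

lemma pinned_Un:
  assumes "pinned E x P" "pinned F x Q" "E \<inter> F = {}"
  shows "pinned (E \<union> F) x (P \<union> Q)"
proof -
  have P: "partition_on E P" and Q: "partition_on F Q" using assms unfolding pinned_def by auto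
  have "partition_on (E \<union> F) (P \<union> Q)"
  proof (rule partition_onI)
    show "\<Union>(P \<union> Q) = E \<union> F" "{} \<notin> P \<union> Q"
      using partition_onD1[OF P] partition_onD1[OF Q] partition_onD3[OF P] partition_onD3[OF Q] by auto
    have PQ: "disjnt B C" if "B \<in> P" "C \<in> Q" for B C
      using that partition_onD1[OF P] partition_onD1[OF Q] assms(3) unfolding disjnt_def by blast
    show "disjnt B C" if "B \<in> P \<union> Q" "C \<in> P \<union> Q" "B \<noteq> C" for B C
      using that PQ disjnt_sym disjointD[OF partition_onD2[OF P]] disjointD[OF partition_onD2[OF Q]]
      unfolding disjnt_def by (metis Int_commute Un_iff)
  qed
  then show ?thesis using assms unfolding pinned_def by auto
qed

lemma complete_edges_image:
  assumes "inj_on f X"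
  shows "complete_edges (f ` X) = (`) f ` complete_edges X"
proof (rule set_eqI)
  fix e
  show "e \<in> complete_edges (f ` X) \<longleftrightarrow> e \<in> (`) f ` complete_edges X"
  proof
    assume "e \<in> complete_edges (f ` X)"
    then obtain p q where "e = {f p, f q}" "p \<in> X" "q \<in> X" "f p \<noteq> f q"
      unfolding complete_edges_iff by auto
    then have "e = f ` {p, q}" "{p, q} \<in> complete_edges X"
      unfolding complete_edges_iff by auto
    then show "e \<in> (`) f ` complete_edges X" by blast
  next
    assume "e \<in> (`) f ` complete_edges X"
    then obtain p q where "e = f ` {p, q}" "p \<in> X" "q \<in> X" "p \<noteq> q"
      by (auto simp: complete_edges_iff)
    then have "e = {f p, f q}" "f p \<noteq> f q" using inj_onD[OF assms] by auto
    then show "e \<in> complete_edges (f ` X)"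
      using \<open>p \<in> X\<close> \<open>q \<in> X\<close> unfolding complete_edges_iff by blast
  qed
qed

lemma pinned_image:
  assumes inj: "inj_on f X" and x: "x \<in> X" and P: "pinned (complete_edges X) x P"
  shows "pinned (complete_edges (f ` X)) (f x) ((`) ((`) f) ` P)"
proof -
  have part: "partition_on (complete_edges X) P" using P unfolding pinned_def by auto
  have injf: "inj_on ((`) f) (complete_edges X)"
    using inj_on_image_Pow[OF inj] unfolding complete_edges_def by (rule inj_on_subset) auto
  have "partition_on ((`) f ` complete_edges X) ((`) ((`) f) ` P)"
  proof (rule partition_onI)
    show "\<Union>((`) ((`) f) ` P) = (`) f ` complete_edges X"
      using partition_onD1[OF part] by auto
    show "disjnt p q" if pq: "p \<in> (`) ((`) f) ` P" "q \<in> (`) ((`) f) ` P" "p \<noteq> q" for p q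
    proof -
      obtain B C where BC: "B \<in> P" "C \<in> P" "p = (`) f ` B" "q = (`) f ` C" using pq(1,2) by auto
      then have "B \<inter> C = {}" using pq(3) partition_onD2[OF part] unfolding disjoint_def by auto
      moreover have "B \<subseteq> complete_edges X" "C \<subseteq> complete_edges X"
        using BC partition_onD1[OF part] by auto
      ultimately show ?thesis
        using inj_on_image_Int[OF injf, of B C] BC unfolding disjnt_def by auto
    qed
    show "{} \<notin> (`) ((`) f) ` P" using part unfolding partition_on_def by auto
  qed
  moreover have "card (\<Union>((`) f ` B)) \<le> card ((`) f ` B) \<and> card ((`) f ` B) \<le> 4 \<and>
      card {e \<in> (`) f ` B. f x \<notin> e} \<le> 3" if B: "B \<in> P" for B
  proof -
    have sub: "B \<subseteq> complete_edges X" using B partition_onD1[OF part] by auto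
    have "card ((`) f ` B) = card B"
      by (rule card_image) (rule inj_on_subset[OF injf sub])
    moreover have "\<Union>((`) f ` B) = f ` \<Union>B" by auto
    moreover have "\<Union>B \<subseteq> X" using sub unfolding complete_edges_def by auto
    then have "card (f ` \<Union>B) = card (\<Union>B)" using inj by (metis card_image inj_on_subset)
    moreover have "{e \<in> (`) f ` B. f x \<notin> e} = (`) f ` {e \<in> B. x \<notin> e}"
    proof -
      have "f x \<in> f ` e \<longleftrightarrow> x \<in> e" if "e \<in> B" for e
        using that sub inj x inj_on_image_mem_iff[OF inj x, of e]
        unfolding complete_edges_def by auto
      then show ?thesis by auto
    qed
    moreover have "card ((`) f ` {e \<in> B. x \<notin> e}) = card {e \<in> B. x \<notin> e}"
      by (rule card_image) (rule inj_on_subset[OF injf], use sub in auto)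
    ultimately show ?thesis using P B unfolding pinned_def by auto
  qed
  ultimately show ?thesis
    unfolding pinned_def complete_edges_image[OF inj] by auto
qed

text \<open>The constructions live on pairs of naturals with one convenient pinned vertex. A
  bijection between the other vertices, extended by sending \<open>y\<close> to \<open>x\<close>,
  carries them to any set of the same size and any vertex in it.\<close>

lemma pinned_transfer:
  assumes fin: "finite X" "finite Y" and card: "card X = card Y" and x: "x \<in> X" and y: "y \<in> Y"
    and P: "pinned (complete_edges Y) y P"
  shows "\<exists>Q. pinned (complete_edges X) x Q"
proof -
  have "card (X - {x}) = card (Y - {y})" using fin card x y by simp
  then obtain g where g: "bij_betw g (Y - {y}) (X - {x})"
    using fin finite_same_card_bij[of "Y - {y}" "X - {x}"] by auto
  define f where "f = g(y := x)"
  have "inj_on f (Y - {y})" "f ` (Y - {y}) = X - {x}" "f y = x"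
    using g unfolding f_def bij_betw_def by (auto simp: inj_on_def)
  moreover from this have "inj_on f (insert y (Y - {y}))" "f ` insert y (Y - {y}) = insert x (X - {x})"
    unfolding inj_on_insert image_insert by simp_all
  ultimately have "inj_on f Y" "f ` Y = X" "f y = x"
    unfolding insert_Diff[OF x] insert_Diff[OF y] by simp_all
  then show ?thesis using pinned_image[OF _ y P, of f] by auto
qed

section \<open>Pinned decompositions from triple packings\<close>

text \<open>A block is the triangle of a triple plus at most one leave edge. Injectivity of
  \<open>F\<close> keeps two leave edges off the same triple, a common vertex keeps the paw at four
  vertices, and a paw must contain \<open>x\<close> because it has four edges.\<close>

lemma pinned_paws:
  assumes T: "triple_packing X T"
    and cover: "leave X T = E ` I"
    and F: "inj_on F I" "F ` I \<subseteq> T"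
    and meet: "\<And>i. i \<in> I \<Longrightarrow> F i \<inter> E i \<noteq> {}"
    and x: "\<And>i. i \<in> I \<Longrightarrow> x \<in> F i \<union> E i"
  shows "\<exists>P. pinned (complete_edges X) x P"
proof -
  \<comment> \<open>\<open>E\<close> may repeat an edge; \<open>inv_into\<close> picks one index for
    each leave edge.\<close>
  define f where "f = (\<lambda>e. F (inv_into I E e))"
  have inv: "inv_into I E e \<in> I" "E (inv_into I E e) = e" if "e \<in> leave X T" for e
    using that unfolding cover by (auto simp: inv_into_into f_inv_into_f)
  have f: "f e \<in> T" "f e \<inter> e \<noteq> {}" "x \<in> f e \<union> e" if "e \<in> leave X T" for e
    using inv[OF that] F(2) meet[of "inv_into I E e"] x[of "inv_into I E e"] unfolding f_def by auto
  have f_inj: "e = e'" if "e \<in> leave X T" "e' \<in> leave X T" "f e = f e'" for e e'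
    using inv[OF that(1)] inv[OF that(2)] that(3) inj_onD[OF F(1)] unfolding f_def by metis
  define blk where "blk = (\<lambda>t. complete_edges t \<union> {e \<in> leave X T. f e = t})"
  have sub: "t \<subseteq> X" and card_t: "card t = 3" if "t \<in> T" for t
    using T that unfolding triple_packing_def by auto
  have uniq: "s = t" if st: "s \<in> T" "t \<in> T" and e: "e \<in> complete_edges X" and "e \<subseteq> s" "e \<subseteq> t" for s t e
  proof -
    obtain p q where "e = {p, q}" "p \<noteq> q" using e unfolding complete_edges_iff by auto
    then show ?thesis using triple_packing_unique[OF T st, of p q] that by auto
  qed
  \<comment> \<open>A leave edge lies in no triple, so only its assignment decides its block; for
    any other edge only the triple covering it matters.\<close>
  have mem: "e \<in> blk t \<longleftrightarrow> (if e \<in> leave X T then f e = t else e \<subseteq> t)"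
    if "e \<in> complete_edges X" "t \<in> T" for e t
    using that unfolding blk_def by (auto simp: complete_edges_def leave_def)
  have blk_sub: "blk t \<subseteq> complete_edges X" if "t \<in> T" for t
    using sub[OF that] unfolding blk_def leave_def complete_edges_def by auto
  have "partition_on (complete_edges X) (blk ` T)"
  proof (rule partition_onI)
    show "\<Union>(blk ` T) = complete_edges X"
    proof (intro equalityI subsetI)
      fix e assume e: "e \<in> complete_edges X"
      show "e \<in> \<Union>(blk ` T)"
      proof (cases "e \<in> leave X T")
        case True
        then show ?thesis using mem[OF e f(1)[OF True]] f(1)[OF True] by auto
      next
        case False
        then obtain t where "t \<in> T" "e \<subseteq> t" using e unfolding leave_def by auto
        then show ?thesis using mem[OF e] False by auto
      qed
    qed (use blk_sub in auto)
    show "disjnt B C" if BC: "B \<in> blk ` T" "C \<in> blk ` T" "B \<noteq> C" for B C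
    proof -
      obtain s t where st: "s \<in> T" "t \<in> T" "B = blk s" "C = blk t" using BC by auto
      have "s = t" if "e \<in> blk s" "e \<in> blk t" for e
      proof -
        have e: "e \<in> complete_edges X" using blk_sub[OF st(1)] that by auto
        show ?thesis
          using that mem[OF e st(1)] mem[OF e st(2)] uniq[OF st(1,2) e] by (auto split: if_splits)
      qed
      then show ?thesis using st BC(3) unfolding disjnt_def by auto
    qed
    show "{} \<notin> blk ` T"
      using card_complete_edges_triple[OF card_t] unfolding blk_def by fastforce
  qed
  moreover have "card (\<Union>(blk t)) \<le> card (blk t) \<and> card (blk t) \<le> 4 \<and>
      card {e \<in> blk t. x \<notin> e} \<le> 3" if t: "t \<in> T" for t
  proof (cases "\<exists>e \<in> leave X T. f e = t")
    case False
    then have "blk t = complete_edges t" unfolding blk_def by auto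
    moreover have "finite (complete_edges t)"
      using card_complete_edges_triple[OF card_t[OF t]] by (intro card_ge_0_finite) simp
    then have "card {e \<in> complete_edges t. x \<notin> e} \<le> card (complete_edges t)"
      by (intro card_mono) auto
    ultimately show ?thesis
      using Union_complete_edges[OF card_t[OF t]] card_complete_edges_triple[OF card_t[OF t]] card_t[OF t]
      by auto
  next
    case True
    then obtain e where e: "e \<in> leave X T" "f e = t" by auto
    then have eq: "blk t = insert e (complete_edges t)" unfolding blk_def using f_inj by auto
    have ne: "e \<notin> complete_edges t" using e t unfolding leave_def complete_edges_def by auto
    have fin: "finite (complete_edges t)"
      using card_complete_edges_triple[OF card_t[OF t]] by (intro card_ge_0_finite) simp
    have c4: "card (blk t) = 4"
      using eq ne fin card_complete_edges_triple[OF card_t[OF t]] by simp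
    have fint: "finite t" using card_t[OF t] by (intro card_ge_0_finite) simp
    obtain p q where pq: "e = {p, q}" "p \<in> t"
    proof -
      obtain p q where "e = {p, q}" using e unfolding leave_def complete_edges_iff by auto
      then show ?thesis using f(2)[OF e(1)] e(2) that[of p q] that[of q p] by auto
    qed
    have "\<Union>(blk t) = insert q t"
      unfolding eq using Union_complete_edges[OF card_t[OF t]] pq by auto
    then have "card (\<Union>(blk t)) \<le> 4"
      using card_t[OF t] fint by (simp add: card_insert_if)
    \<comment> \<open>Some edge of the paw contains \<open>x\<close>, so those missing
      \<open>x\<close> are a proper subset of four edges.\<close>
    moreover have "\<exists>d\<in>blk t. x \<in> d"
      using f(3)[OF e(1)] e(2) eq Union_complete_edges[OF card_t[OF t]] by auto
    then have "{d \<in> blk t. x \<notin> d} \<subset> blk t" by auto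
    then have "card {d \<in> blk t. x \<notin> d} < card (blk t)"
      using fin eq by (intro psubset_card_mono) auto
    ultimately show ?thesis using c4 by auto
  qed
  ultimately have "pinned (complete_edges X) x (blk ` T)" unfolding pinned_def by auto
  then show ?thesis ..
qed

text \<open>A triangle has only three edges, so the bound holds for every \<open>x\<close>, inside
  \<open>X\<close> or not.\<close>

lemma pinned_steiner:
  assumes "triple_packing X T" "leave X T = {}"
  shows "\<exists>P. pinned (complete_edges X) x P"
  using pinned_paws[of X T "\<lambda>_. {}" "{}" "\<lambda>_. {}" x] assms by auto

lemma leave_insert:
  assumes "triple_packing X T" "x \<notin> X"
  shows "leave (insert x X) T = leave X T \<union> (\<lambda>p. {x, p}) ` X"
proof -
  have "x \<notin> t" if "t \<in> T" for t using assms that unfolding triple_packing_def by auto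
  then show ?thesis using assms(2) unfolding leave_def complete_edges_iff
    by (auto simp: complete_edges_iff doubleton_eq_iff)
qed

text \<open>The leave on the enlarged set is the star at \<open>x\<close>. Its edge at
  \<open>p\<close> hangs on the triple \<open>g p\<close>, and every paw contains \<open>x\<close>
  through its pendant edge.\<close>

lemma pinned_pendants:
  assumes T: "triple_packing X T" "leave X T = {}" and x: "x \<notin> X"
    and g: "inj_on g X" "\<And>p. p \<in> X \<Longrightarrow> g p \<in> T \<and> p \<in> g p"
  shows "\<exists>P. pinned (complete_edges (insert x X)) x P"
proof (rule pinned_paws[of _ T "\<lambda>p. {x, p}" X g])
  show "triple_packing (insert x X) T" using T(1) unfolding triple_packing_def by blast
  show "leave (insert x X) T = (\<lambda>p. {x, p}) ` X" using leave_insert[OF T(1) x] T(2) by simp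
qed (use g in auto)

text \<open>\<open>S\<close> splits into pairs \<open>q\<close>, \<open>r\<close>; the 4-cycle
  through \<open>x\<close>, \<open>q\<close>, \<open>y\<close>, \<open>r\<close> has four vertices
  and only two edges missing \<open>x\<close>.\<close>

lemma pinned_four_cycles:
  assumes "finite S" "even (card S)" "x \<notin> S" "y \<notin> S" "x \<noteq> y"
  shows "\<exists>P. pinned ((\<lambda>q. {x, q}) ` S \<union> (\<lambda>q. {y, q}) ` S) x P"
  using assms
proof (induction "card S" arbitrary: S rule: less_induct)
  case less
  show ?case
  proof (cases "S = {}")
    case True
    then have "pinned ((\<lambda>q. {x, q}) ` S \<union> (\<lambda>q. {y, q}) ` S) x {}"
      by (simp add: pinned_def partition_on_def)
    then show ?thesis ..
  next
    case False
    then obtain q where q: "q \<in> S" by auto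
    have "card S \<noteq> 1" using less.prems by auto
    then have "S \<noteq> {q}" by auto
    then obtain r where r: "r \<in> S" "r \<noteq> q" using q by auto
    define S' where "S' = S - {q, r}"
    have S: "S = insert q (insert r S')" "q \<notin> S'" "r \<notin> S'" "finite S'"
      using q r less.prems unfolding S'_def by auto
    then have cS: "card S = Suc (Suc (card S'))" using r by simp
    obtain P where P: "pinned ((\<lambda>q. {x, q}) ` S' \<union> (\<lambda>q. {y, q}) ` S') x P"
      using less.hyps[of S'] cS S less.prems by auto
    let ?C = "{{x, q}, {y, q}, {x, r}, {y, r}}"
    have ne: "q \<noteq> x" "q \<noteq> y" "r \<noteq> x" "r \<noteq> y" using q r less.prems by auto
    have "card ?C = 4" using ne r less.prems by (simp add: doubleton_eq_iff)
    moreover have "\<Union>?C = {x, y, q, r}" by auto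
    moreover have "card {x, y, q, r} \<le> 4" by (simp add: card_insert_if)
    moreover have "{e \<in> ?C. x \<notin> e} \<subseteq> {{y, q}, {y, r}}" by auto
    then have "card {e \<in> ?C. x \<notin> e} \<le> card {{y, q}, {y, r}}" by (intro card_mono) auto
    then have "card {e \<in> ?C. x \<notin> e} \<le> 3" by (simp add: card_insert_if split: if_splits)
    ultimately have "pinned ?C x {?C}"
      unfolding pinned_def by (auto simp: partition_on_def)
    moreover have "?C \<inter> ((\<lambda>q. {x, q}) ` S' \<union> (\<lambda>q. {y, q}) ` S') = {}"
      using S ne less.prems by (auto simp: doubleton_eq_iff)
    ultimately have "pinned (?C \<union> ((\<lambda>q. {x, q}) ` S' \<union> (\<lambda>q. {y, q}) ` S')) x ({?C} \<union> P)"
      using P by (intro pinned_Un)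
    moreover have "?C \<union> ((\<lambda>q. {x, q}) ` S' \<union> (\<lambda>q. {y, q}) ` S')
        = (\<lambda>q. {x, q}) ` S \<union> (\<lambda>q. {y, q}) ` S"
      unfolding S(1) by auto
    ultimately show ?thesis by auto
  qed
qed

text \<open>\<open>x\<close>, \<open>y\<close> and one vertex \<open>p\<close> of \<open>X\<close>
  span a triangle. The other vertices of \<open>X\<close> are even in number, so their edges to
  \<open>x\<close> and \<open>y\<close> split into 4-cycles.\<close>

lemma pinned_two_more:
  assumes T: "triple_packing X T" "leave X T = {}"
    and X: "finite X" "odd (card X)" and xy: "x \<notin> X" "y \<notin> X" "x \<noteq> y"
  shows "\<exists>P. pinned (complete_edges (insert x (insert y X))) x P"
proof -
  have "X \<noteq> {}" using X by auto
  then obtain p where p: "p \<in> X" by auto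
  have ne: "p \<noteq> x" "p \<noteq> y" using p xy by auto
  obtain P where P: "pinned (complete_edges X) x P" using pinned_steiner[OF T] by auto
  let ?S = "X - {p}"
  let ?E = "(\<lambda>q. {x, q}) ` ?S \<union> (\<lambda>q. {y, q}) ` ?S"
  have "even (card ?S)" using X p by simp
  then obtain Q where Q: "pinned ?E x Q"
    using pinned_four_cycles[of ?S x y] X xy by auto
  have "card {x, y, p} = 3" using ne xy by auto
  then obtain R where R: "pinned (complete_edges {x, y, p}) x R"
    using pinned_steiner[of "{x, y, p}" "{{x, y, p}}" x]
    unfolding triple_packing_def leave_def complete_edges_def by auto
  have tri: "complete_edges {x, y, p} = {{x, y}, {x, p}, {y, p}}"
  proof (intro equalityI subsetI)
    show "e \<in> {{x, y}, {x, p}, {y, p}}" if "e \<in> complete_edges {x, y, p}" for e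
      using that by (auto simp: complete_edges_iff)
    show "e \<in> complete_edges {x, y, p}" if "e \<in> {{x, y}, {x, p}, {y, p}}" for e
      using that ne xy by (auto simp: doubleton_in_complete_edges)
  qed
  \<comment> \<open>Edges of \<open>?E\<close> join \<open>{x, y}\<close> to \<open>?S\<close>;
    edges in \<open>X\<close> avoid \<open>{x, y}\<close> and those of the triangle avoid
    \<open>?S\<close>, so the three parts are disjoint.\<close>
  have E: "x \<in> e \<or> y \<in> e" "\<exists>q\<in>?S. q \<in> e" if "e \<in> ?E" for e using that by auto
  have S: "q \<notin> {x, y, p}" if "q \<in> ?S" for q using that xy by auto
  have "e \<notin> ?E" "e \<notin> complete_edges {x, y, p}" if "e \<in> complete_edges X" for e
    using that xy E(1)[of e] unfolding tri by (auto simp: complete_edges_def)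
  moreover have "e \<notin> complete_edges {x, y, p}" if "e \<in> ?E" for e
    using E(2)[OF that] S unfolding complete_edges_def by blast
  ultimately have "complete_edges X \<inter> ?E = {}"
      "(complete_edges X \<union> ?E) \<inter> complete_edges {x, y, p} = {}"
    unfolding disjoint_iff Un_iff[of _ "complete_edges X"] by metis+
  then have "pinned ((complete_edges X \<union> ?E) \<union> complete_edges {x, y, p}) x ((P \<union> Q) \<union> R)"
    by (intro pinned_Un P Q R)
  moreover have "(complete_edges X \<union> ?E) \<union> complete_edges {x, y, p}
      = complete_edges (insert x (insert y X))"
  proof -
    define Ex where "Ex = (\<lambda>q. {x, q}) ` ?S"
    define Ey where "Ey = (\<lambda>q. {y, q}) ` ?S"
    have X': "insert p ?S = X" "X - {y} = X" "insert y X - {x} = insert y X" using p xy by auto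
    then have im: "(\<lambda>q. {x, q}) ` X = insert {x, p} Ex" "(\<lambda>q. {y, q}) ` X = insert {y, p} Ey"
      unfolding Ex_def Ey_def using image_insert[of _ p ?S] by metis+
    have "complete_edges (insert x (insert y X)) =
        (complete_edges X \<union> insert {y, p} Ey) \<union> insert {x, y} (insert {x, p} Ex)"
      by (simp only: complete_edges_insert X' im image_insert)
    then show ?thesis unfolding tri Ex_def[symmetric] Ey_def[symmetric] by (simp add: Un_ac insert_commute)
  qed
  ultimately show ?thesis by auto
qed

text \<open>The leave is a perfect matching, and \<open>x\<close> is joined to each of its edges.
  Distinct matching edges are disjoint, so two new triples share only \<open>x\<close>.\<close>

lemma triple_packing_extend:
  assumes T: "triple_packing X T" and x: "x \<notin> X"
    and matching: "\<And>p. p \<in> X \<Longrightarrow> \<exists>!e. e \<in> leave X T \<and> p \<in> e"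
  shows "triple_packing (insert x X) (T \<union> insert x ` leave X T)"
    and "leave (insert x X) (T \<union> insert x ` leave X T) = {}"
proof -
  let ?L = "leave X T"
  have L: "e \<subseteq> X" "card e = 2" "x \<notin> e" if "e \<in> ?L" for e
    using that x unfolding leave_def complete_edges_def by auto
  have Tx: "x \<notin> t" if "t \<in> T" for t using T that x unfolding triple_packing_def by auto
  have uniq: "e = d" if "e \<in> ?L" "d \<in> ?L" "p \<in> e" "p \<in> d" for e d p
  proof -
    have "p \<in> X" using L(1)[OF that(1)] that by auto
    then show ?thesis using matching[of p] that by auto
  qed
  \<comment> \<open>\<open>x\<close> is in no old triple, so two common points would be the ends of
    \<open>e\<close>, and \<open>t\<close> would cover a leave edge.\<close>
  have mix: "p = q" if "t \<in> T" and e: "e \<in> ?L" and "p \<in> t" "q \<in> t" "p \<in> insert x e" "q \<in> insert x e" for t e p q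
  proof (rule ccontr)
    assume "p \<noteq> q"
    have "p \<in> e" "q \<in> e" using that Tx by auto
    moreover obtain a b where "e = {a, b}" using L(2)[OF e] unfolding card_2_iff by auto
    ultimately have "e \<subseteq> t" using that \<open>p \<noteq> q\<close> by auto
    then show False using that unfolding leave_def by auto
  qed
  have c3: "card (insert x e) = 3" if "e \<in> ?L" for e
    using L[OF that] by (simp add: card_insert_if card_ge_0_finite)
  have unique: "s = t" if st: "s \<in> T \<union> insert x ` ?L" "t \<in> T \<union> insert x ` ?L"
      and "p \<in> s" "p \<in> t" "q \<in> s" "q \<in> t" "p \<noteq> q" for s t p q
  proof -
    consider "s \<in> T" "t \<in> T" | "s \<in> T" "t \<in> insert x ` ?L" | "s \<in> insert x ` ?L" "t \<in> T"
      | e d where "e \<in> ?L" "d \<in> ?L" "s = insert x e" "t = insert x d"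
      using st by blast
    then show ?thesis
    proof cases
      case 1
      then show ?thesis using triple_packing_unique[OF T] that by auto
    next
      case 2
      then show ?thesis using mix[of s] that by auto
    next
      case 3
      then show ?thesis using mix[of t] that by auto
    next
      case 4
      then show ?thesis using uniq[of e d p] uniq[of e d q] that by auto
    qed
  qed
  show "triple_packing (insert x X) (T \<union> insert x ` ?L)"
    unfolding triple_packing_def
  proof (intro conjI ballI impI)
    fix t assume "t \<in> T \<union> insert x ` ?L"
    then consider "t \<in> T" | e where "e \<in> ?L" "t = insert x e" by blast
    then have "t \<subseteq> insert x X \<and> card t = 3"
    proof cases
      case 1
      then have "t \<subseteq> X" "card t = 3" using T unfolding triple_packing_def by auto
      then show ?thesis by auto
    next
      case 2
      then show ?thesis using L(1)[of e] c3[of e] by auto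
    qed
    then show "t \<subseteq> insert x X" "card t = 3" by auto
  next
    fix s t p q
    assume "s \<in> T \<union> insert x ` ?L" "t \<in> T \<union> insert x ` ?L" "p \<in> s \<inter> t" "q \<in> s \<inter> t" "p \<noteq> q"
    then show "s = t" using unique[of s t p q] by simp
  qed
  have "\<exists>t \<in> T \<union> insert x ` ?L. e \<subseteq> t" if e: "e \<in> complete_edges (insert x X)" for e
  proof (cases "e \<subseteq> X")
    case True
    then have "e \<in> ?L \<or> (\<exists>t\<in>T. e \<subseteq> t)" using e unfolding leave_def complete_edges_def by auto
    then show ?thesis by blast
  next
    case False
    then obtain p where "e = {x, p}" "p \<in> X" using e unfolding complete_edges_iff by auto
    moreover obtain d where "d \<in> ?L" "p \<in> d" using matching[OF \<open>p \<in> X\<close>] by auto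
    ultimately have "e \<subseteq> insert x d" "insert x d \<in> insert x ` ?L" by auto
    then show ?thesis by blast
  qed
  then show "leave (insert x X) (T \<union> insert x ` ?L) = {}" unfolding leave_def by auto
qed

section \<open>A commutative quasigroup on the residues modulo \<open>m\<close>\<close>

text \<open>
  For \<open>s < m\<close> this permutes the residues so that \<open>half m ((i + i) mod m)\<close> is \<open>i\<close> for all \<open>i\<close>
  if \<open>m\<close> is odd, and for the lower half of the \<open>i\<close> if \<open>m\<close> is even.
\<close>

definition half :: "nat \<Rightarrow> nat \<Rightarrow> nat" where
  "half m s = (if even s then s div 2 else (s + m) div 2)"

text \<open>Idempotent for odd \<open>m\<close>, as Bose's construction needs, and half-idempotent
  for even \<open>m\<close>, as Skolem's needs.\<close>

definition qop :: "nat \<Rightarrow> nat \<Rightarrow> nat \<Rightarrow> nat" where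
  "qop m i j = half m ((i + j) mod m)"

lemma qop_commute: "qop m i j = qop m j i"
  by (simp add: qop_def add.commute)

lemma half_less: "s < m \<Longrightarrow> half m s < m"
  unfolding half_def by auto

text \<open>Even arguments land below all odd ones, and \<open>half m\<close> is injective on each
  parity class.\<close>

lemma half_inj: "s < m \<Longrightarrow> t < m \<Longrightarrow> half m s = half m t \<Longrightarrow> s = t"
  unfolding half_def by (auto split: if_splits elim!: evenE oddE)

lemma qop_less: "i < m \<Longrightarrow> qop m i j < m"
  unfolding qop_def by (rule half_less) simp

lemma qop_cancel:
  assumes "i < m" "j < m" "k < m" "qop m i j = qop m i k"
  shows "j = k"
proof -
  have "(i + j) mod m = (i + k) mod m"
    using assms half_inj[of "(i + j) mod m" m "(i + k) mod m"] unfolding qop_def by auto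
  then show ?thesis using assms(1-3) by (auto simp: mod_if split: if_splits)
qed

lemma qop_solvable:
  assumes "i < m" "k < m"
  shows "\<exists>j<m. qop m i j = k"
proof -
  have "qop m i ` {..<m} \<subseteq> {..<m}" using assms qop_less by auto
  moreover have "inj_on (qop m i) {..<m}" using qop_cancel[OF assms(1)] by (auto simp: inj_on_def)
  ultimately have "qop m i ` {..<m} = {..<m}" by (simp add: endo_inj_surj)
  then show ?thesis using assms by (auto simp: image_iff) (metis assms(2) imageE lessThan_iff)
qed

text \<open>For odd \<open>m\<close>, reducing \<open>i + i\<close> flips its parity exactly when it
  wraps, and \<open>half\<close> then adds \<open>m\<close> back. For even \<open>m\<close> the
  reduced value stays even, so a wrapped \<open>i\<close> loses \<open>m div 2\<close>.\<close>

lemma qop_self: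
  assumes "i < m"
  shows "qop m i i = (if odd m \<or> i < m div 2 then i else i - m div 2)"
proof -
  have "(i + i) mod m = (if i + i < m then i + i else i + i - m)"
    using assms by (simp add: mod_if)
  then show ?thesis
    using assms unfolding qop_def half_def by (auto split: if_splits elim!: evenE oddE)
qed

section \<open>The Bose and Skolem triples on three levels\<close>

abbreviation grid :: "nat \<Rightarrow> (nat \<times> nat) set" where
  "grid m \<equiv> {..<m} \<times> {..<3}"

definition tri :: "nat \<Rightarrow> nat \<Rightarrow> nat \<Rightarrow> nat \<Rightarrow> (nat \<times> nat) set" where
  "tri m i j a = {(i, a), (j, a), (qop m i j, Suc a mod 3)}"

definition base :: "nat \<Rightarrow> (nat \<times> nat) set" where
  "base i = {(i, 0), (i, 1), (i, 2)}"

text \<open>For odd \<open>m\<close> this is Bose's triple system. For even \<open>m\<close> only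
  the columns below \<open>m div 2\<close> are idempotent, and it is Skolem's system without the
  triples through the point at infinity.\<close>

definition bose :: "nat \<Rightarrow> (nat \<times> nat) set set" where
  "bose m = {tri m i j a |i j a. i < m \<and> j < m \<and> i \<noteq> j \<and> a < 3} \<union> {base i |i. i < m \<and> qop m i i = i}"

lemma less3: "(a::nat) < 3 \<longleftrightarrow> a = 0 \<or> a = 1 \<or> a = 2"
  by auto

lemma tri_commute: "tri m i j a = tri m j i a"
  unfolding tri_def using qop_commute by auto

lemma tri_in_bose: "i < m \<Longrightarrow> j < m \<Longrightarrow> i \<noteq> j \<Longrightarrow> a < 3 \<Longrightarrow> tri m i j a \<in> bose m"
  unfolding bose_def by blast

lemma base_in_bose: "i < m \<Longrightarrow> qop m i i = i \<Longrightarrow> base i \<in> bose m"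
  unfolding bose_def by blast

lemma bose_same_level:
  assumes "t \<in> bose m" "(i, a) \<in> t" "(j, a) \<in> t" "i \<noteq> j"
  shows "t = tri m i j a"
proof -
  consider (tri) i' j' b where "t = tri m i' j' b" "b < 3" | (base) k where "t = base k"
    using assms(1) unfolding bose_def by auto
  then show ?thesis
  proof cases
    case tri
    have "Suc b mod 3 \<noteq> b" by presburger
    then have "b = a" "i = i' \<and> j = j' \<or> i = j' \<and> j = i'"
      using assms unfolding tri(1) unfolding tri_def by auto
    then show ?thesis using tri(1) tri_commute[of m i j a] by auto
  next
    case base
    then show ?thesis using assms unfolding base_def by auto
  qed
qed

text \<open>Such a pair determines the solution \<open>j\<close> of \<open>qop m i j = k\<close>:
  \<open>j \<noteq> i\<close> gives a mixed triple, \<open>j = i\<close> the column of an idempotent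
  \<open>i\<close>.\<close>

lemma bose_next_level:
  assumes "t \<in> bose m" "(i, a) \<in> t" "(k, Suc a mod 3) \<in> t"
  shows "(\<exists>j<m. j \<noteq> i \<and> qop m i j = k \<and> t = tri m i j a) \<or> (k = i \<and> qop m i i = i \<and> t = base i)"
proof -
  consider (tri) i' j' b where "t = tri m i' j' b" "b < 3" "i' \<noteq> j'" "i' < m" "j' < m"
    | (base) l where "t = base l" "qop m l l = l"
    using assms(1) unfolding bose_def by auto
  then show ?thesis
  proof cases
    case tri
    \<comment> \<open>If \<open>(i, a)\<close> were the third point of the triple, the next level
      would hold no point of it.\<close>
    have "Suc (Suc b mod 3) mod 3 \<noteq> b" "Suc (Suc b mod 3) mod 3 \<noteq> Suc b mod 3" by presburger+
    then have "b = a" using assms(2,3) unfolding tri(1) tri_def by auto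
    moreover have "Suc a mod 3 \<noteq> a" by presburger
    ultimately have "(i = i' \<or> i = j') \<and> k = qop m i' j'"
      using assms tri unfolding tri_def by auto
    then show ?thesis using tri tri_commute[of m i' j'] qop_commute[of m i' j'] \<open>b = a\<close> by metis
  next
    case base
    then show ?thesis using assms unfolding base_def by auto
  qed
qed

lemma bose_level: "t \<in> bose m \<Longrightarrow> (i, a) \<in> t \<Longrightarrow> i < m \<and> a < 3"
  unfolding bose_def tri_def base_def by (auto simp: qop_less)

lemma level_cases:
  assumes "a < 3" "b < 3"
  obtains "a = b" | "b = Suc a mod 3" | "a = Suc b mod (3::nat)"
  using assms unfolding less3 by force

lemma bose_next_unique:
  assumes "s \<in> bose m" "t \<in> bose m" "(i, a) \<in> s" "(i, a) \<in> t"
    "(k, Suc a mod 3) \<in> s" "(k, Suc a mod 3) \<in> t"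
  shows "s = t"
proof -
  have "i < m" using assms bose_level by auto
  then show ?thesis
    using bose_next_level[OF assms(1,3,5)] bose_next_level[OF assms(2,4,6)] qop_cancel by metis
qed

lemma card_bose:
  assumes "t \<in> bose m" shows "card t = 3"
proof -
  have "Suc a mod 3 \<noteq> a" "a \<noteq> Suc a mod 3" for a by presburger+
  then show ?thesis using assms unfolding bose_def tri_def base_def by (auto simp: card_insert_if)
qed

lemma triple_packing_bose: "triple_packing (grid m) (bose m)"
  unfolding triple_packing_def
proof (intro conjI ballI impI)
  show "t \<subseteq> grid m" "card t = 3" if "t \<in> bose m" for t
    using bose_level[OF that] card_bose[OF that] by auto
  fix s t p q
  assume st: "s \<in> bose m" "t \<in> bose m" "p \<in> s \<inter> t" "q \<in> s \<inter> t" "p \<noteq> q"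
  obtain i a j b where pq: "p = (i, a)" "q = (j, b)" by (meson surj_pair)
  then have "a < 3" "b < 3" using st bose_level by auto
  then show "s = t"
  proof (cases rule: level_cases)
    case 1
    then show ?thesis
      using bose_same_level[of s m i a j] bose_same_level[of t m i a j] st pq by auto
  next
    case 2
    then show ?thesis using bose_next_unique[OF st(1,2), of i a j] st(3,4) pq by auto
  next
    case 3
    then show ?thesis using bose_next_unique[OF st(1,2), of j b i] st(3,4) pq by auto
  qed
qed

text \<open>Pairs on one level are always covered. A pair on consecutive levels is missed only if
  the solution of \<open>qop m i j = k\<close> is \<open>j = i\<close> with \<open>i\<close> not
  idempotent.\<close>

lemma leave_bose:
  "leave (grid m) (bose m) =
     {{(i, a), (qop m i i, Suc a mod 3)} |i a. i < m \<and> a < 3 \<and> qop m i i \<noteq> i}"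
proof (intro equalityI subsetI)
  fix e assume e: "e \<in> leave (grid m) (bose m)"
  then have nc: "\<And>t. t \<in> bose m \<Longrightarrow> \<not> e \<subseteq> t" unfolding leave_def by auto
  have main: "e \<in> {{(i, a), (qop m i i, Suc a mod 3)} |i a. i < m \<and> a < 3 \<and> qop m i i \<noteq> i}"
    if eq: "e = {(i, a), (k, Suc a mod 3)}" and "i < m" "k < m" "a < 3" for i a k
  proof -
    obtain j where j: "j < m" "qop m i j = k" using qop_solvable[OF \<open>i < m\<close> \<open>k < m\<close>] by auto
    have "e \<subseteq> tri m i j a" using eq j unfolding tri_def by auto
    then have "j = i" using nc[OF tri_in_bose[of i m j a]] that j by auto
    moreover have "e \<subseteq> base i" if "k = i" using that eq \<open>a < 3\<close> unfolding base_def less3 by auto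
    then have "k \<noteq> i" using nc[OF base_in_bose[of i m]] that j calculation by auto
    ultimately show ?thesis using that j by auto
  qed
  obtain p q where "e = {p, q}" "p \<in> grid m" "q \<in> grid m" "p \<noteq> q"
    using e unfolding leave_def complete_edges_iff by auto
  then obtain i a j b where eq: "e = {(i, a), (j, b)}" "i < m" "j < m" "a < 3" "b < 3" "(i, a) \<noteq> (j, b)"
    by auto
  from \<open>a < 3\<close> \<open>b < 3\<close> show "e \<in> {{(i, a), (qop m i i, Suc a mod 3)} |i a. i < m \<and> a < 3 \<and> qop m i i \<noteq> i}"
  proof (cases rule: level_cases)
    case 1
    then have "e \<subseteq> tri m i j a" "i \<noteq> j" using eq unfolding tri_def by auto
    then show ?thesis using nc[OF tri_in_bose[of i m j a]] eq by auto
  next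
    case 2
    then show ?thesis using main[of i a j] eq by auto
  next
    case 3
    then show ?thesis using main[of j b i] eq by (auto simp: insert_commute)
  qed
next
  fix e assume "e \<in> {{(i, a), (qop m i i, Suc a mod 3)} |i a. i < m \<and> a < 3 \<and> qop m i i \<noteq> i}"
  then obtain i a where e: "e = {(i, a), (qop m i i, Suc a mod 3)}" "i < m" "a < 3" "qop m i i \<noteq> i"
    by auto
  have "\<not> e \<subseteq> t" if "t \<in> bose m" for t
    using bose_next_level[OF that, of i a "qop m i i"] e qop_cancel[of i m _ i] by auto
  moreover have "e \<in> complete_edges (grid m)"
    unfolding e(1) doubleton_in_complete_edges using e qop_less[of i m i] by auto
  ultimately show "e \<in> leave (grid m) (bose m)" unfolding leave_def by auto
qed

lemma leave_bose_odd: "odd m \<Longrightarrow> leave (grid m) (bose m) = {}"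
  unfolding leave_bose by (auto simp: qop_self)

section \<open>The perfect matching left for even \<open>m\<close>\<close>

lemma leave_bose_even:
  assumes "m = 2 * h"
  shows "leave (grid m) (bose m) =
    (\<lambda>(i, a). {(i + h, a), (i, Suc a mod 3)}) ` ({..<h} \<times> {..<3})"
proof (intro equalityI subsetI)
  have self: "qop m i i = (if i < h then i else i - h)" if "i < m" for i
    using qop_self[OF that] assms by auto
  fix e
  show "e \<in> (\<lambda>(i, a). {(i + h, a), (i, Suc a mod 3)}) ` ({..<h} \<times> {..<3})"
    if L: "e \<in> leave (grid m) (bose m)"
  proof -
    obtain i a where e: "e = {(i, a), (qop m i i, Suc a mod 3)}" "i < m" "a < 3" "qop m i i \<noteq> i"
      using L unfolding leave_bose by blast
    \<comment> \<open>A non-idempotent \<open>i\<close> is at least \<open>h\<close>, so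
      \<open>i - h\<close> does not truncate.\<close>
    then have "e = {(i - h + h, a), (i - h, Suc a mod 3)}" "i - h < h"
      using self[OF e(2)] assms by (auto split: if_splits)
    then show ?thesis using e(3) by (intro image_eqI[of _ _ "(i - h, a)"]) auto
  qed
  show "e \<in> leave (grid m) (bose m)"
    if L: "e \<in> (\<lambda>(i, a). {(i + h, a), (i, Suc a mod 3)}) ` ({..<h} \<times> {..<3})"
  proof -
    obtain i a where e: "e = {(i + h, a), (i, Suc a mod 3)}" "i < h" "a < 3"
      using L by auto
    then have "qop m (i + h) (i + h) = i" "i + h < m" "i \<noteq> i + h" using self[of "i + h"] assms by auto
    then show ?thesis
      using e unfolding leave_bose by (intro CollectI exI[of _ "i + h"] exI[of _ a]) simp
  qed
qed

text \<open>Two distinct points on level \<open>a\<close> cannot both be the single point on level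
  \<open>Suc b mod 3\<close>, so \<open>a = b\<close> and the unordered pair can be read
  off.\<close>

lemma tri_eq_iff:
  assumes "i \<noteq> j" "i' \<noteq> j'"
  shows "tri m i j a = tri m i' j' b \<longleftrightarrow> a = b \<and> (i = i' \<and> j = j' \<or> i = j' \<and> j = i')"
proof
  assume eq: "tri m i j a = tri m i' j' b"
  have "a \<noteq> Suc a mod 3" "b \<noteq> Suc b mod 3" by presburger+
  moreover have "(i, a) \<in> tri m i' j' b" "(j, a) \<in> tri m i' j' b"
    using eq unfolding tri_def by auto
  ultimately have "a = b" using assms unfolding tri_def by auto
  then show "a = b \<and> (i = i' \<and> j = j' \<or> i = j' \<and> j = i')"
    using \<open>(i, a) \<in> tri m i' j' b\<close> \<open>(j, a) \<in> tri m i' j' b\<close> \<open>b \<noteq> Suc b mod 3\<close> assms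
    unfolding tri_def by auto
qed (auto simp: tri_commute)

lemma tri_neq_base:
  assumes "i \<noteq> j" shows "tri m i j a \<noteq> base k"
proof
  assume "tri m i j a = base k"
  then have "(i, a) \<in> base k" "(j, a) \<in> base k" unfolding tri_def by auto
  then show False using assms unfolding base_def by auto
qed

lemma matching_bose_even:
  assumes m: "m = 2 * h" and p: "p \<in> grid m"
  shows "\<exists>!e. e \<in> leave (grid m) (bose m) \<and> p \<in> e"
proof -
  obtain k b where kb: "p = (k, b)" "k < m" "b < 3" using p by auto
  \<comment> \<open>Lower-half points are second ends of leave edges, upper-half points first ends;
    going back one level is adding 2 modulo 3.\<close>
  define i where "i = (if k < h then k else k - h)"
  define a where "a = (if k < h then (b + 2) mod 3 else b)"
  have "a < 3" using kb unfolding a_def by auto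
  have ia: "(i', a') = (i, a)" if "i' < h" "a' < 3" "p \<in> {(i' + h, a'), (i', Suc a' mod 3)}" for i' a'
  proof -
    have "(Suc a' mod 3 + 2) mod 3 = a'" using that(2) by presburger
    then show ?thesis using that kb m unfolding i_def a_def by auto
  qed
  have "Suc ((b + 2) mod 3) mod 3 = b" using kb by presburger
  then have pe: "p \<in> {(i + h, a), (i, Suc a mod 3)}" and "i < h"
    using kb m unfolding i_def a_def by auto
  show ?thesis unfolding leave_bose_even[OF m]
  proof (intro ex1I conjI)
    show "{(i + h, a), (i, Suc a mod 3)} \<in> (\<lambda>(i, a). {(i + h, a), (i, Suc a mod 3)}) ` ({..<h} \<times> {..<3})"
      using \<open>i < h\<close> \<open>a < 3\<close> by (intro image_eqI[of _ _ "(i, a)"]) auto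
    show "p \<in> {(i + h, a), (i, Suc a mod 3)}" by (rule pe)
    fix e assume "e \<in> (\<lambda>(i, a). {(i + h, a), (i, Suc a mod 3)}) ` ({..<h} \<times> {..<3}) \<and> p \<in> e"
    then obtain i' a' where e: "e = {(i' + h, a'), (i', Suc a' mod 3)}" "i' < h" "a' < 3" "p \<in> e"
      by auto
    then have "(i', a') = (i, a)" using ia[of i' a'] by blast
    then show "e = {(i + h, a), (i, Suc a mod 3)}" using e(1) by simp
  qed
qed

text \<open>\<open>(0, 3)\<close>, outside the three levels, is the point at infinity of a Steiner
  triple system on \<open>6 * h + 1\<close> points.\<close>

lemma skolem:
  assumes m: "m = 2 * h"
  shows "triple_packing (insert (0, 3) (grid m))
      (bose m \<union> insert (0, 3) ` leave (grid m) (bose m))"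
    and "leave (insert (0, 3) (grid m))
      (bose m \<union> insert (0, 3) ` leave (grid m) (bose m)) = {}"
  using triple_packing_extend[OF triple_packing_bose, of "(0, 3)" m] matching_bose_even[OF m] by auto

section \<open>Assigning pendant edges to distinct triples\<close>

text \<open>A leave edge missing \<open>(0, 0)\<close> needs a triple through \<open>(0, 0)\<close>.
  There are \<open>3 * h - 1\<close> such edges and equally many such triples, so each of these
  triples is used once.\<close>

lemma pinned_bose_even:
  assumes m: "m = 2 * h" and h: "h \<ge> 1"
  shows "\<exists>P. pinned (complete_edges (grid m)) (0, 0) P"
proof (rule pinned_paws[OF triple_packing_bose leave_bose_even[OF m]])
  let ?I = "{..<h} \<times> {..<3::nat}"
  \<comment> \<open>The pairs that the triples through \<open>(0, 0)\<close> cut out of the other points and the edges of the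
    leave are two matchings. Their union consists of even cycles, and \<open>F\<close> orients these cycles.
    The leave edge at \<open>(0, 0)\<close> may go to any unused triple that meets it.\<close>
  define F where "F = (\<lambda>(i, a::nat). if a = 2 then (if i = 0 then tri m 0 h 2 else tri m 0 i 0)
    else if a = 0 then tri m 0 (i + h) 0 else if i = 0 then base 0 else tri m i (m - i) 2)"
  have base0: "base 0 \<in> bose m" using h m by (intro base_in_bose) (auto simp: qop_self)
  have F2: "F (i, 2) = (if i = 0 then tri m 0 h 2 else tri m 0 i 0)"
    and F0: "F (i, 0) = tri m 0 (i + h) 0"
    and F1: "F (i, Suc 0) = (if i = 0 then base 0 else tri m i (m - i) 2)" for i
    unfolding F_def by auto
  show "F ` ?I \<subseteq> bose m"
  proof (rule image_subsetI)
    fix p assume "p \<in> ?I"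
    then show "F p \<in> bose m"
      using base0 h m unfolding F_def by (auto intro!: tri_in_bose)
  qed
  show "inj_on F ?I"
  proof (rule inj_onI)
    fix p q assume pq: "p \<in> ?I" "q \<in> ?I" "F p = F q"
    obtain i a j b where ia: "p = (i, a)" "q = (j, b)" by (meson surj_pair)
    have ij: "i < h" "a < 3" "j < h" "b < 3" and eq: "F (i, a) = F (j, b)" using pq ia by auto
    \<comment> \<open>Level and index pair tell the triples apart: level 0 with
      \<open>{0, i}\<close> or \<open>{0, i + h}\<close>, level 2 with \<open>{0, h}\<close> or
      \<open>{i, m - i}\<close> where \<open>i\<close> is the smaller; the column differs from
      all.\<close>
    have "a = 0 \<or> a = Suc 0 \<or> a = 2" "b = 0 \<or> b = Suc 0 \<or> b = 2" using ij by auto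
    then show "p = q"
      using eq ij m h unfolding ia
      by (elim disjE; auto simp add: F0 F1 F2 tri_eq_iff tri_neq_base tri_neq_base[symmetric] split: if_splits)
  qed
  \<comment> \<open>\<open>i + (m - i)\<close> reduces to 0 and \<open>half m 0 = 0\<close>; level 2
    is followed by level 0.\<close>
  have wrap: "(0, 0) \<in> tri m i (m - i) 2" if "i < m" for i
    using that unfolding tri_def qop_def half_def by auto
  show "F p \<inter> (case p of (i, a) \<Rightarrow> {(i + h, a), (i, Suc a mod 3)}) \<noteq> {}"
    "(0, 0) \<in> F p \<union> (case p of (i, a) \<Rightarrow> {(i + h, a), (i, Suc a mod 3)})" if p: "p \<in> ?I" for p
  proof -
    obtain i a where ia: "p = (i, a)" "i < h" "a = 0 \<or> a = Suc 0 \<or> a = 2" using p by force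
    have "i < m" using ia m by simp
    from ia(3) have "F p \<inter> {(i + h, a), (i, Suc a mod 3)} \<noteq> {} \<and>
        (0, 0) \<in> F p \<union> {(i + h, a), (i, Suc a mod 3)}"
      using wrap[OF \<open>i < m\<close>]
      by (elim disjE) (auto simp: ia(1) F0 F1 F2 tri_def base_def)
    then show "F p \<inter> (case p of (i, a) \<Rightarrow> {(i + h, a), (i, Suc a mod 3)}) \<noteq> {}"
      "(0, 0) \<in> F p \<union> (case p of (i, a) \<Rightarrow> {(i + h, a), (i, Suc a mod 3)})"
      using ia(1) by simp_all
  qed
qed

text \<open>On each level, cyclically adjacent residues form \<open>m\<close> pairs, distinct
  because \<open>m \<ge> 3\<close>. The triple on \<open>i\<close> and its predecessor goes to
  \<open>i\<close>.\<close>

lemma pinned_bose_odd_pendants: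
  assumes m: "odd m" "m \<ge> 3" and x: "x \<notin> grid m"
  shows "\<exists>P. pinned (complete_edges (insert x (grid m))) x P"
proof (rule pinned_pendants[OF triple_packing_bose leave_bose_odd[OF m(1)] x])
  define pre where "pre = (\<lambda>i. if i = 0 then m - 1 else i - 1)"
  define g where "g = (\<lambda>(i, a). tri m i (pre i) a)"
  have pre: "pre i < m" "pre i \<noteq> i" if "i < m" for i using that m unfolding pre_def by auto
  show "inj_on g (grid m)"
  proof (rule inj_onI)
    fix p q assume pq: "p \<in> grid m" "q \<in> grid m" "g p = g q"
    obtain i a j b where ia: "p = (i, a)" "q = (j, b)" by (meson surj_pair)
    have ij: "i < m" "j < m" and eq: "g (i, a) = g (j, b)" using pq ia by auto
    have "a = b \<and> (i = j \<or> i = pre j \<and> pre i = j)"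
      using eq ij pre(2)[of i] pre(2)[of j] unfolding g_def by (auto simp: tri_eq_iff)
    then show "p = q" using ij m unfolding ia pre_def by (auto split: if_splits)
  qed
  show "g p \<in> bose m \<and> p \<in> g p" if p: "p \<in> grid m" for p
  proof -
    obtain i a where "p = (i, a)" "i < m" "a < 3" using p by auto
    then show ?thesis using tri_in_bose[of i m "pre i" a] pre[of i] unfolding g_def tri_def by auto
  qed
qed

text \<open>On each level a path of adjacent residues serves the points with
  \<open>i \<noteq> 0\<close>; a cycle would repeat its pair for \<open>m = 2\<close>. The three
  points of column 0 and the point at infinity remain.\<close>

lemma pinned_skolem_pendants:
  assumes m: "m = 2 * h" and h: "h \<ge> 1" and x: "x \<notin> insert (0, 3) (grid m)"
  shows "\<exists>P. pinned (complete_edges (insert x (insert (0, 3) (grid m)))) x P"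
proof (rule pinned_pendants[OF skolem[OF m] x])
  let ?L = "leave (grid m) (bose m)"
  \<comment> \<open>\<open>E a\<close> is the Skolem triple over a leave edge at column 0. It
    contains \<open>(0, Suc a mod 3)\<close> and \<open>(0, 3)\<close>, hence \<open>E 0\<close>,
    \<open>E 1\<close>, \<open>E 2\<close> go to \<open>(0, 1)\<close>, \<open>(0, 2)\<close>,
    \<open>(0, 3)\<close>, and \<open>base 0\<close> to \<open>(0, 0)\<close>.\<close>
  define E where "E = (\<lambda>a::nat. {(0, 3), (h, a), (0::nat, Suc a mod 3)})"
  define g where "g = (\<lambda>(i, a). if a = 3 then E 2 else if i \<noteq> 0 then tri m (i - 1) i a
    else if a = 0 then base 0 else E (a - 1))"
  have EL: "E a \<in> insert (0, 3) ` ?L" if "a < 3" for a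
  proof -
    have "{(h, a), (0, Suc a mod 3)} \<in> ?L"
      unfolding leave_bose_even[OF m] using h that by (intro image_eqI[of _ _ "(0, a)"]) auto
    then show ?thesis unfolding E_def by blast
  qed
  have base0: "base 0 \<in> bose m" using h m by (intro base_in_bose) (auto simp: qop_self)
  have E_inj: "a = b" if "E a = E b" "a < 3" for a b
  proof -
    have "(h, a) \<in> E a" unfolding E_def by simp
    then have "(h, a) \<in> E b" using that(1) by simp
    then show ?thesis using that(2) h unfolding E_def by auto
  qed
  have E_neq: "E 0 \<noteq> E 1" "E 0 \<noteq> E 2" "E 1 \<noteq> E 2" "E 1 \<noteq> E 0" "E 2 \<noteq> E 0" "E 2 \<noteq> E 1"
    using E_inj[of 0 1] E_inj[of 0 2] E_inj[of 1 2] by auto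
  have neq_E: "t \<noteq> E a" if "t \<in> bose m" for t a
    using bose_level[OF that, of 0 3] unfolding E_def by auto
  have tri: "tri m (i - 1) i a \<in> bose m" if "i < m" "i \<noteq> 0" "a < 3" for i a
    using that by (intro tri_in_bose) auto
  note nE = neq_E[OF base0] neq_E[OF tri]
  have g: "g (0, 3) = E 2" "g (0, 0) = base 0" "g (0, 1) = E 0" "g (0, 2) = E 1"
    "\<And>i a. i \<noteq> 0 \<Longrightarrow> a < 3 \<Longrightarrow> g (i, a) = tri m (i - 1) i a"
    unfolding g_def by auto
  show "inj_on g (insert (0, 3) (grid m))"
  proof (rule inj_onI)
    fix p q assume pq: "p \<in> insert (0, 3) (grid m)" "q \<in> insert (0, 3) (grid m)"
      and eq: "g p = g q"
    obtain i a j b where ia: "p = (i, a)" "q = (j, b)" by (meson surj_pair)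
    have cs: "a = 3 \<and> i = 0 \<or> i \<noteq> 0 \<and> i < m \<and> a < 3 \<or> i = 0 \<and> a = 0 \<or> i = 0 \<and> a = 1 \<or> i = 0 \<and> a = 2"
      if "(i, a) \<in> insert (0, 3) (grid m)" for i a
      using that by auto
    have gt: "g (i, a) = tri m (i - 1) i a" "tri m (i - 1) i a \<noteq> base 0" "base 0 \<noteq> tri m (i - 1) i a"
      "tri m (i - 1) i a \<noteq> E c" "E c \<noteq> tri m (i - 1) i a"
      if "i \<noteq> 0" "i < m" "a < 3" for i a c
    proof -
      show "g (i, a) = tri m (i - 1) i a" using that by (intro g(5))
      have "i - 1 \<noteq> i" using that by simp
      then show "tri m (i - 1) i a \<noteq> base 0" by (rule tri_neq_base)
      then show "base 0 \<noteq> tri m (i - 1) i a" by (rule not_sym)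
      show "tri m (i - 1) i a \<noteq> E c" using that by (intro nE(2))
      then show "E c \<noteq> tri m (i - 1) i a" by (rule not_sym)
    qed
    have tt: "i = j \<and> a = b" if "i \<noteq> 0" "j \<noteq> 0" "tri m (i - 1) i a = tri m (j - 1) j b"
    proof -
      have "i - 1 \<noteq> i" "j - 1 \<noteq> j" using that by auto
      then show ?thesis using tri_eq_iff[of "i - 1" i "j - 1" j m a b] that by auto
    qed
    from cs[OF pq(1)[unfolded ia]] cs[OF pq(2)[unfolded ia]] show "p = q"
      using eq tt unfolding ia
      by (elim disjE conjE; simp only: g(1-4) gt nE(1) nE(1)[symmetric] E_neq simp_thms)
  qed
  show "g p \<in> bose m \<union> insert (0, 3) ` ?L \<and> p \<in> g p" if p: "p \<in> insert (0, 3) (grid m)" for p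
  proof -
    obtain i a where ia: "p = (i, a)" by (meson surj_pair)
    then have "a = 3 \<and> i = 0 \<or> i \<noteq> 0 \<and> i < m \<and> a < 3 \<or> i = 0 \<and> a = 0 \<or> i = 0 \<and> a = 1 \<or> i = 0 \<and> a = 2"
      using p by auto
    then show ?thesis
      using tri[of i a] base0 EL[of 2] EL[of 0] EL[of 1] unfolding ia
      by (elim disjE) (auto simp: g_def E_def tri_def base_def)
  qed
qed

section \<open>All vertex counts from five on, and the theorem\<close>

lemma exists_pinned:
  assumes fin: "finite X" and x: "x \<in> X" and card: "card X \<ge> 5"
  shows "\<exists>P. pinned (complete_edges X) x P"
proof -
  define m where "m = card X div 3"
  define Y where "Y = grid m"
  have finY: "finite Y" and cardY: "card Y = 3 * m" unfolding Y_def by auto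
  have new: "(0, 3) \<notin> Y" "(0, 4) \<notin> Y" unfolding Y_def by auto
  have "m \<ge> 1" using card unfolding m_def by auto
  have "card X = 3 * m + card X mod 3" unfolding m_def by simp
  moreover have "card X mod 3 < 3" by simp
  ultimately consider "card X = 3 * m" | "card X = 3 * m + 1" | "card X = 3 * m + 2" by linarith
  then have "\<exists>(Z :: (nat \<times> nat) set) z P. finite Z \<and> card Z = card X \<and> z \<in> Z \<and> pinned (complete_edges Z) z P"
  proof cases
    case 1
    have "(0, 0) \<in> Y" using \<open>m \<ge> 1\<close> unfolding Y_def by auto
    moreover have "\<exists>P. pinned (complete_edges Y) (0, 0) P"
    proof (cases "odd m")
      case True
      then show ?thesis
        using pinned_steiner[OF triple_packing_bose leave_bose_odd] unfolding Y_def by simp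
    next
      case False
      then show ?thesis using pinned_bose_even[of m "m div 2"] \<open>m \<ge> 1\<close> unfolding Y_def by force
    qed
    ultimately show ?thesis using finY cardY 1 by (intro exI[of _ Y] exI[of _ "(0, 0)"]) auto
  next
    case 2
    have "\<exists>P. pinned (complete_edges (insert (0, 3) Y)) (0, 3) P"
    proof (cases "odd m")
      case True
      \<comment> \<open>\<open>m = 1\<close> would mean only four vertices.\<close>
      then have "m \<ge> 3" using 2 card by (auto elim!: oddE)
      then show ?thesis using True pinned_bose_odd_pendants new unfolding Y_def by blast
    next
      case False
      then have "m = 2 * (m div 2)" by simp
      then show ?thesis using pinned_steiner[OF skolem(1)[of m "m div 2"] skolem(2)[of m "m div 2"]] unfolding Y_def by simp
    qed
    then show ?thesis using finY cardY new 2 by (intro exI[of _ "insert (0, 3) Y"] exI[of _ "(0, 3)"]) auto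
  next
    case 3
    have "\<exists>P. pinned (complete_edges (insert (0, 4) (insert (0, 3) Y))) (0, 4) P"
    proof (cases "odd m")
      case True
      then show ?thesis
        using pinned_two_more[OF triple_packing_bose leave_bose_odd, of m "(0, 4)" "(0, 3)"] new finY cardY
        unfolding Y_def by auto
    next
      case False
      then have "m = 2 * (m div 2)" "m div 2 \<ge> 1" using \<open>m \<ge> 1\<close> by auto
      then show ?thesis using pinned_skolem_pendants[of m "m div 2" "(0, 4)"] new unfolding Y_def by auto
    qed
    then show ?thesis using finY cardY new 3
      by (intro exI[of _ "insert (0, 4) (insert (0, 3) Y)"] exI[of _ "(0, 4)"]) auto
  qed
  then obtain Z :: "(nat \<times> nat) set" and z P where "finite Z" "card Z = card X" "z \<in> Z" "pinned (complete_edges Z) z P"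
    by blast
  then show ?thesis using pinned_transfer[OF fin _ _ x] by metis
qed

theorem theorem5p1:
  fixes X V :: "'a set" and v w :: nat
  assumes "finite X" and "V \<subseteq> X"
    and "card V = v" and "card X = v + w"
    and "v + w \<ge> 5"
  shows "(w \<ge> 1 \<longrightarrow> cost_ON2 X V 4 3 = cost_ON X 4) \<and>
         (w = 0 \<longrightarrow> cost_ON2 X V 4 3 = cost_ON V 3)"
proof (intro conjI impI)
  assume "w \<ge> 1"
  then have "V \<noteq> X" using assms by auto
  then obtain x where "x \<in> X" "x \<notin> V" using assms by auto
  moreover then obtain P where "pinned (complete_edges X) x P"
    using exists_pinned[of X x] assms by auto
  ultimately show "cost_ON2 X V 4 3 = cost_ON X 4" using cost_eq_if_pinned[OF assms(1)] by blast
next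
  assume "w = 0"
  then have V: "V = X" using assms by (intro card_subset_eq) auto
  \<comment> \<open>With \<open>V = X\<close> every edge lies inside \<open>V\<close>, so the bound
    3 applies to whole blocks and implies the bound 4.\<close>
  have "{e \<in> B. e \<subseteq> X} = B" if "B \<in> P" "partition_on (complete_edges X) P" for B P
    using that unfolding partition_on_def complete_edges_def by blast
  then have "(\<forall>B\<in>P. card B \<le> 4) \<and> (\<forall>B\<in>P. card {e \<in> B. e \<subseteq> X} \<le> 3) \<longleftrightarrow> (\<forall>B\<in>P. card B \<le> 3)"
    if "partition_on (complete_edges X) P" for P
    using that by fastforce
  then have "grooming2 X X 4 3 P \<longleftrightarrow> grooming X 3 P" for P
    unfolding grooming2_def grooming_def by blast
  then show "cost_ON2 X V 4 3 = cost_ON V 3" unfolding cost_ON2_def cost_ON_def V by presburger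
qed

end
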